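(* Let $\mu>-1/2$ and let $m\ge 0$ be an integer. For $\operatorname{Re}s>0$ the Mellin transforms $M_n^\mu(s)$ defined in the context satisfy the recursions $$M_{2m+1}^\mu(s)=2M_{2m}^\mu(s+1)-4m\,M_{2m-1}^\mu(s)$$ (the last term being absent when $m=0$), and $$M_{2m+2}^\mu(s)=2M_{2m+1}^\mu(s+1)-2(2m+2\mu+1)M_{2m}^\mu(s).$$
   Context: Generalized Hermite polynomials, for $\mu>-1/2$: $H_{2n}^\mu(x)=(-1)^n2^{2n}n!\,L_n^{\mu-1/2}(x^2)$ and $H_{2n+1}^\mu(x)=(-1)^n2^{2n+1}n!\,x\,L_n^{\mu+1/2}(x^2)$, where $L_n^\alpha(x)=\binom{n+\alpha}{n}\,{}_1F_1(-n;\alpha+1;x)$ are the Laguerre polynomials. Their Mellin transforms are, for $\operatorname{Re}s>0$, $$M_n^\mu(s)=\int_0^\infty x^{s-1}H_n^\mu(x)x^\mu e^{-x^2/2}\,dx .$$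
   Formalization: The second recursion is stated only for Re s > -μ (in addition to Re s > 0), because for -1/2 < μ < 0 and 0 < Re s ≤ -μ the integrals defining M_{2m}^μ(s) and M_{2m+2}^μ(s) diverge at 0. *)

theory Defs
  imports "HOL-Analysis.Analysis"
begin

definition hyp_1F1 :: "real \<Rightarrow> real \<Rightarrow> real \<Rightarrow> real" where
  "hyp_1F1 a b x = eval_fps (fps_hypergeo [a] [b] 1) x"

definition laguerre :: "nat \<Rightarrow> real \<Rightarrow> real \<Rightarrow> real" where
  "laguerre n \<alpha> x = ((real n + \<alpha>) gchoose n) * hyp_1F1 (- real n) (\<alpha> + 1) x"

definition gen_hermite :: "real \<Rightarrow> nat \<Rightarrow> real \<Rightarrow> real" where
  "gen_hermite \<mu> n x =
    (let k = n div 2 in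
     if even n then (-1) ^ k * 2 ^ (2 * k) * fact k * laguerre k (\<mu> - 1/2) (x\<^sup>2)
     else (-1) ^ k * 2 ^ (2 * k + 1) * fact k * x * laguerre k (\<mu> + 1/2) (x\<^sup>2))"

text \<open>Near \<open>0\<close> the integrand below is of order \<open>x powr (Re s - 1 + \<mu>)\<close> for even \<open>n\<close> and
  \<open>x powr (Re s + \<mu>)\<close> for odd \<open>n\<close>. Given \<open>\<mu> > -1/2\<close> and \<open>Re s > 0\<close>, the integral therefore
  converges for every odd \<open>n\<close>, but for even \<open>n\<close> only if \<open>Re s > -\<mu>\<close>, which is an extra
  condition when \<open>\<mu> < 0\<close>. Where it diverges, the Bochner integral has the default value \<open>0\<close>.\<close>

definition hermite_mellin :: "real \<Rightarrow> nat \<Rightarrow> complex \<Rightarrow> complex" where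
  "hermite_mellin \<mu> n s =
    (LINT x:{0<..}|lborel. complex_of_real x powr (s - 1) *
      complex_of_real (gen_hermite \<mu> n x * x powr \<mu> * exp (- x\<^sup>2 / 2)))"

end

theory Submission
  imports Defs
begin

text \<open>Pascal's rule and the absorption identity for the coefficients of the Laguerre polynomials
  give \<open>L (n, \<alpha> + 1) = L (n, \<alpha>) + L (n - 1, \<alpha> + 1)\<close> and
  \<open>x L (n, \<alpha> + 1) = (n + \<alpha> + 1) L (n, \<alpha>) - (n + 1) L (n + 1, \<alpha>)\<close>. These are the pointwise three-term
  recurrences of the generalized Hermite polynomials, and multiplication by \<open>x\<close> shifts the
  argument of the Mellin transform by one. Integrability of each term, needed to split the
  integral, reduces to that of the Gamma integral because \<open>exp (- x\<^sup>2 / 2) \<le> exp (1/2 - x)\<close>.\<close>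

section \<open>Laguerre polynomials: explicit form and contiguous relations\<close>

lemma pochhammer_minus_of_nat_div_fact:
  assumes "k \<le> n"
  shows "pochhammer (- real n) k / fact n = (-1) ^ k / fact (n - k)"
proof -
  have "fact n = fact (n - k) * pochhammer (1 + real (n - k)) k"
    using pochhammer_product'[of "1 :: real" "n - k" k] assms by (simp add: pochhammer_fact)
  then have "pochhammer (real n - real k + 1) k = fact n / fact (n - k)"
    using assms by (simp add: of_nat_diff add.commute add_diff_eq)
  then show ?thesis
    by (simp add: pochhammer_minus)
qed

text \<open>The upper parameter \<open>- real n\<close> makes the hypergeometric series stop at
  degree \<open>n\<close>. The prefactor, a Pochhammer symbol over \<open>fact n\<close>, absorbs
  the denominators \<open>pochhammer (\<alpha> + 1) k\<close>, which are positive for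
  \<open>\<alpha> > -1\<close>.\<close>

lemma laguerre_eq_sum:
  assumes "\<alpha> > -1"
  shows "laguerre n \<alpha> x = (\<Sum>k\<le>n. (-1) ^ k * ((real n + \<alpha>) gchoose (n - k)) / fact k * x ^ k)"
proof -
  have coeff: "((real n + \<alpha>) gchoose n) * (pochhammer (- real n) k / (pochhammer (\<alpha> + 1) k * fact k))
      = (-1) ^ k * ((real n + \<alpha>) gchoose (n - k)) / fact k" if "k \<le> n" for k
  proof -
    have pos: "pochhammer (\<alpha> + 1) k > 0"
      using assms by (intro pochhammer_pos) simp
    have "((real n + \<alpha>) gchoose n) * (pochhammer (- real n) k / (pochhammer (\<alpha> + 1) k * fact k))
        = pochhammer (\<alpha> + 1) n / pochhammer (\<alpha> + 1) k * (pochhammer (- real n) k / fact n) / fact k"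
      by (simp add: gbinomial_pochhammer' add.commute)
    also have "pochhammer (\<alpha> + 1) n / pochhammer (\<alpha> + 1) k = pochhammer (\<alpha> + 1 + real k) (n - k)"
      using pos pochhammer_product[OF that, of "\<alpha> + 1"] by simp
    also have "\<dots> = fact (n - k) * ((real n + \<alpha>) gchoose (n - k))"
      using that by (simp add: gbinomial_pochhammer' of_nat_diff algebra_simps)
    finally show ?thesis
      using pochhammer_minus_of_nat_div_fact[OF that] by simp
  qed
  have "hyp_1F1 (- real n) (\<alpha> + 1) x
      = (\<Sum>k\<le>n. pochhammer (- real n) k / (pochhammer (\<alpha> + 1) k * fact k) * x ^ k)"
    unfolding hyp_1F1_def eval_fps_def
    by (subst suminf_finite[of "{..n}"]) (auto simp: pochhammer_of_nat_eq_0_lemma)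
  then show ?thesis
    unfolding laguerre_def by (simp only: sum_distrib_left mult.assoc[symmetric])
      (intro sum.cong refl, simp only: atMost_iff coeff)
qed

lemma laguerre_Suc_add_one:
  assumes "\<alpha> > -1"
  shows "laguerre (Suc n) (\<alpha> + 1) x = laguerre (Suc n) \<alpha> x + laguerre n (\<alpha> + 1) x"
proof -
  have pascal: "(real (Suc n) + (\<alpha> + 1)) gchoose (Suc n - k)
      = ((real (Suc n) + \<alpha>) gchoose (Suc n - k)) + ((real n + (\<alpha> + 1)) gchoose (n - k))"
    if "k \<le> n" for k
    using gbinomial_Suc_Suc[of "real (Suc n) + \<alpha>" "n - k"] that
    by (simp add: Suc_diff_le add_ac)
  define c where "c k = (-1) ^ k / fact k * x ^ k" for k
  have lag: "laguerre l \<beta> x = (\<Sum>k\<le>l. c k * ((real l + \<beta>) gchoose (l - k)))" if "\<beta> > -1" for l \<beta>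
    using that by (simp add: laguerre_eq_sum c_def mult_ac)
  \<comment> \<open>Only \<open>k \<le> n\<close> is compared: at \<open>k = Suc n\<close> the
    binomial coefficient is 1 for both \<open>\<alpha> + 1\<close> and
    \<open>\<alpha>\<close>.\<close>
  have "(\<Sum>k\<le>n. c k * ((real (Suc n) + (\<alpha> + 1)) gchoose (Suc n - k)))
      = (\<Sum>k\<le>n. c k * ((real (Suc n) + \<alpha>) gchoose (Suc n - k)))
        + (\<Sum>k\<le>n. c k * ((real n + (\<alpha> + 1)) gchoose (n - k)))"
    unfolding sum.distrib[symmetric]
    by (intro sum.cong refl) (simp only: atMost_iff pascal distrib_left)
  then show ?thesis
    using assms by (simp add: lag del: of_nat_Suc)
qed

text \<open>With \<open>t k\<close> the terms of \<open>laguerre (Suc n) \<alpha> x\<close>, the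
  left side is minus the sum of \<open>k * t k\<close>, that is, \<open>- x\<close> times the
  derivative of that polynomial. Splitting \<open>- k\<close> as
  \<open>(n + 1 - k) - (n + 1)\<close> lets absorption turn the first part into
  \<open>laguerre n \<alpha> x\<close>.\<close>

lemma mult_laguerre_add_one:
  assumes "\<alpha> > -1"
  shows "x * laguerre n (\<alpha> + 1) x
    = (real n + \<alpha> + 1) * laguerre n \<alpha> x - (real n + 1) * laguerre (Suc n) \<alpha> x"
proof -
  define t where "t k = (-1) ^ k * ((real (Suc n) + \<alpha>) gchoose (Suc n - k)) / fact k * x ^ k" for k
  have shift: "real n + (\<alpha> + 1) = real (Suc n) + \<alpha>" by simp
  have "laguerre n (\<alpha> + 1) x
      = (\<Sum>k\<le>n. (-1) ^ k * ((real (Suc n) + \<alpha>) gchoose (n - k)) / fact k * x ^ k)"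
    using laguerre_eq_sum[of "\<alpha> + 1" n x] assms unfolding shift by simp
  then have "x * laguerre n (\<alpha> + 1) x = - (\<Sum>k\<le>n. real (Suc k) * t (Suc k))"
    by (simp add: t_def sum_distrib_left sum_negf[symmetric] mult_ac del: of_nat_Suc)
  \<comment> \<open>The added term \<open>k = 0\<close> has weight 0.\<close>
  also have "(\<Sum>k\<le>n. real (Suc k) * t (Suc k)) = (\<Sum>k\<le>Suc n. real k * t k)"
    by (subst sum.atMost_Suc_shift) simp
  also have "- \<dots> = (\<Sum>k\<le>Suc n. (real (Suc n) - real k) * t k) - real (Suc n) * (\<Sum>k\<le>Suc n. t k)"
    by (simp add: sum_distrib_left sum_subtractf[symmetric] algebra_simps sum_negf[symmetric]
        del: of_nat_Suc sum.atMost_Suc)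
  also have "(\<Sum>k\<le>Suc n. (real (Suc n) - real k) * t k) = (\<Sum>k\<le>n. (real (Suc n) - real k) * t k)"
    by simp
  also have "\<dots> = (real n + \<alpha> + 1) * laguerre n \<alpha> x"
    using assms unfolding laguerre_eq_sum[OF assms] sum_distrib_left
  proof (intro sum.cong refl)
    fix k assume "k \<in> {..n}"
    then have "(real (Suc n) - real k) * ((real (Suc n) + \<alpha>) gchoose (Suc n - k))
        = (real n + \<alpha> + 1) * ((real n + \<alpha>) gchoose (n - k))"
      using Suc_times_gbinomial[of "n - k" "real n + \<alpha>"]
      by (simp add: Suc_diff_le of_nat_diff algebra_simps)
    then show "(real (Suc n) - real k) * t k
        = (real n + \<alpha> + 1) * ((-1) ^ k * ((real n + \<alpha>) gchoose (n - k)) / fact k * x ^ k)"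
      unfolding t_def by (simp add: mult_ac)
  qed
  also have "(\<Sum>k\<le>Suc n. t k) = laguerre (Suc n) \<alpha> x"
    by (simp only: laguerre_eq_sum[OF assms] t_def)
  finally show ?thesis
    by (simp add: add.commute)
qed

section \<open>Pointwise recurrences of the generalized Hermite polynomials\<close>

lemma gen_hermite_even:
  "gen_hermite \<mu> (2 * m) x = (-1) ^ m * 2 ^ (2 * m) * fact m * laguerre m (\<mu> - 1/2) (x\<^sup>2)"
  by (simp add: gen_hermite_def Let_def)

lemma gen_hermite_odd:
  "gen_hermite \<mu> (2 * m + 1) x
    = (-1) ^ m * 2 ^ (2 * m + 1) * fact m * x * laguerre m (\<mu> + 1/2) (x\<^sup>2)"
  by (simp add: gen_hermite_def Let_def)

text \<open>An instance of \<open>laguerre_Suc_add_one\<close> at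
  \<open>\<alpha> = \<mu> - 1/2\<close>; the alternating sign of the normalization turns its plus
  into a minus. For \<open>m = 0\<close> the index \<open>2 * m - 1\<close> truncates to 0, but its
  coefficient vanishes.\<close>

lemma gen_hermite_odd_rec:
  assumes "\<mu> > -1/2"
  shows "gen_hermite \<mu> (2 * m + 1) x
    = 2 * x * gen_hermite \<mu> (2 * m) x - 4 * real m * gen_hermite \<mu> (2 * m - 1) x"
proof (cases m)
  case 0
  have "laguerre 0 (\<mu> + 1/2) (x\<^sup>2) = 1" "laguerre 0 (\<mu> - 1/2) (x\<^sup>2) = 1"
    using assms by (simp_all add: laguerre_eq_sum)
  with 0 show ?thesis
    by (simp add: gen_hermite_def Let_def)
next
  case (Suc n)
  have idx: "2 * Suc n - 1 = 2 * n + 1" by simp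
  have rec: "laguerre (Suc n) (\<mu> + 1/2) (x\<^sup>2)
      = laguerre (Suc n) (\<mu> - 1/2) (x\<^sup>2) + laguerre n (\<mu> + 1/2) (x\<^sup>2)"
    using laguerre_Suc_add_one[of "\<mu> - 1/2" n "x\<^sup>2"] assms by (simp add: add.commute)
  show ?thesis
    unfolding Suc idx gen_hermite_even gen_hermite_odd rec
    by (simp add: algebra_simps)
qed

lemma gen_hermite_even_rec:
  assumes "\<mu> > -1/2"
  shows "gen_hermite \<mu> (2 * m + 2) x
    = 2 * x * gen_hermite \<mu> (2 * m + 1) x - 2 * (2 * real m + 2 * \<mu> + 1) * gen_hermite \<mu> (2 * m) x"
proof -
  have idx: "2 * m + 2 = 2 * Suc m" by simp
  have rec: "(real m + 1) * laguerre (Suc m) (\<mu> - 1/2) (x\<^sup>2)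
      = (real m + \<mu> + 1/2) * laguerre m (\<mu> - 1/2) (x\<^sup>2) - x\<^sup>2 * laguerre m (\<mu> + 1/2) (x\<^sup>2)"
    using mult_laguerre_add_one[of "\<mu> - 1/2" "x\<^sup>2" m] assms by (simp add: algebra_simps)
  \<comment> \<open>Splitting \<open>fact (Suc m)\<close> exposes the factor
    \<open>real m + 1\<close> that \<open>rec\<close> carries on its left.\<close>
  have "gen_hermite \<mu> (2 * m + 2) x = - ((-1) ^ m * 2 ^ (2 * m + 2) * fact m)
      * ((real m + 1) * laguerre (Suc m) (\<mu> - 1/2) (x\<^sup>2))"
    unfolding idx gen_hermite_even by (simp add: mult_ac)
  then show ?thesis
    unfolding rec gen_hermite_even gen_hermite_odd
    by (simp add: algebra_simps power2_eq_square)
qed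

section \<open>Integrability of the Mellin integrands\<close>

lemma set_integrable_powr_mult_exp_neg_square:
  fixes z :: complex
  assumes "Re z > 0"
  shows "set_integrable lborel {0<..}
    (\<lambda>x. complex_of_real x powr (z - 1) * complex_of_real (exp (- x\<^sup>2 / 2)))"
proof (rule set_integrable_bound)
  \<comment> \<open>The Gamma integral is available over the completed measure; descending to
    \<open>lborel\<close> requires Borel measurability of its integrand.\<close>
  have [measurable]:
    "(\<lambda>x. indicator {0<..} x *\<^sub>R (complex_of_real x powr (z - 1) / complex_of_real (exp x)))
      \<in> borel_measurable borel"
    by (intro borel_measurable_continuous_on_indicator continuous_intros) auto
  have "set_integrable lborel {0<..}
      (\<lambda>x. complex_of_real x powr (z - 1) / complex_of_real (exp x))"
    using absolutely_integrable_Gamma_integral'[OF assms]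
    unfolding set_integrable_def by (subst (asm) integrable_completion) simp_all
  then show "set_integrable lborel {0<..}
      (\<lambda>x. complex_of_real (exp (1/2)) *
        (complex_of_real x powr (z - 1) / complex_of_real (exp x)))"
    by (rule set_integrable_mult_right)
  show "set_borel_measurable lborel {0<..}
      (\<lambda>x. complex_of_real x powr (z - 1) * complex_of_real (exp (- x\<^sup>2 / 2)))"
    unfolding set_borel_measurable_def measurable_lborel2
    by (intro borel_measurable_continuous_on_indicator continuous_intros) auto
  \<comment> \<open>The right side is the tangent at 1 of the concave left side; its slope
    \<open>-1\<close> matches the Gamma integrand.\<close>
  have "- x\<^sup>2 / 2 \<le> 1/2 - x" for x :: real
    using zero_le_power2[of "x - 1"] by (simp add: power2_eq_square algebra_simps)
  then have "exp (- x\<^sup>2 / 2) \<le> exp (1/2) / exp x" for x :: real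
    by (simp flip: exp_diff)
  then have "cmod (complex_of_real x powr (z - 1)) * exp (- x\<^sup>2 / 2)
      \<le> cmod (complex_of_real x powr (z - 1)) * (exp (1/2) / exp x)" for x
    by (intro mult_left_mono) auto
  then show "AE x in lborel. x \<in> {0<..} \<longrightarrow>
      norm (complex_of_real x powr (z - 1) * complex_of_real (exp (- x\<^sup>2 / 2)))
      \<le> norm (complex_of_real (exp (1/2)) *
          (complex_of_real x powr (z - 1) / complex_of_real (exp x)))"
    by (simp add: norm_mult norm_divide mult_ac)
qed

text \<open>The function \<open>f\<close> is left arbitrary so that explicit sums of monomials can
  replace \<open>gen_hermite \<mu> n\<close>.\<close>

abbreviation mellin_integrand :: "real \<Rightarrow> (real \<Rightarrow> real) \<Rightarrow> complex \<Rightarrow> real \<Rightarrow> complex" where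
  "mellin_integrand \<mu> f s x \<equiv> complex_of_real x powr (s - 1) *
      complex_of_real (f x * x powr \<mu> * exp (- x\<^sup>2 / 2))"

text \<open>For positive \<open>x\<close> a monomial and the weight \<open>x powr \<mu>\<close>
  merge with the Mellin kernel into one power with exponent \<open>s + \<mu> + e k - 1\<close>, so
  each term is integrable by the preceding bound.\<close>

lemma set_integrable_mellin_sum:
  assumes "\<And>k. k \<in> A \<Longrightarrow> Re s + \<mu> + real (e k) > 0"
  shows "set_integrable lborel {0<..} (mellin_integrand \<mu> (\<lambda>x. \<Sum>k\<in>A. c k * x ^ e k) s)"
proof -
  have "set_integrable lborel {0<..} (\<lambda>x. \<Sum>k\<in>A. complex_of_real (c k) *
      (complex_of_real x powr ((s + of_real \<mu> + of_nat (e k)) - 1) * complex_of_real (exp (- x\<^sup>2 / 2))))"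
    unfolding set_integrable_def scaleR_sum_right
    by (intro Bochner_Integration.integrable_sum set_integrable_mult_right[unfolded set_integrable_def]
        set_integrable_powr_mult_exp_neg_square[unfolded set_integrable_def]) (use assms in auto)
  moreover have "(\<Sum>k\<in>A. complex_of_real (c k) *
      (complex_of_real x powr ((s + of_real \<mu> + of_nat (e k)) - 1) * complex_of_real (exp (- x\<^sup>2 / 2))))
      = mellin_integrand \<mu> (\<lambda>x. \<Sum>k\<in>A. c k * x ^ e k) s x" if "x \<in> {0<..}" for x
  proof -
    have "complex_of_real x powr ((s + of_real \<mu> + of_nat (e k)) - 1)
        = complex_of_real x powr (s - 1) * complex_of_real (x powr \<mu>) * complex_of_real x ^ e k" for k
    proof -
      have "(s + of_real \<mu> + of_nat (e k)) - 1 = (s - 1) + of_real \<mu> + of_nat (e k)" by simp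
      then show ?thesis
        using that by (simp only: powr_add) (simp add: powr_nat' powr_of_real)
    qed
    then show ?thesis
      by (simp add: sum_distrib_left sum_distrib_right mult_ac)
  qed
  ultimately show ?thesis
    by (subst (asm) set_integrable_cong[OF refl refl]) auto
qed

text \<open>The lowest exponent in the sum is 0, which dictates the bound on
  \<open>Re s\<close>.\<close>

lemma set_integrable_gen_hermite_even:
  assumes "\<mu> > -1/2" "Re s > - \<mu>"
  shows "set_integrable lborel {0<..} (mellin_integrand \<mu> (gen_hermite \<mu> (2 * m)) s)"
proof -
  have "gen_hermite \<mu> (2 * m) = (\<lambda>x. \<Sum>k\<le>m. (-1) ^ m * 2 ^ (2 * m) * fact m *
      ((-1) ^ k * ((real m + (\<mu> - 1/2)) gchoose (m - k)) / fact k) * x ^ (2 * k))"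
    using assms(1) unfolding gen_hermite_even
    by (simp add: fun_eq_iff laguerre_eq_sum sum_distrib_left mult_ac flip: power_mult)
  then show ?thesis
    using assms(2) by (simp only:) (rule set_integrable_mellin_sum, auto)
qed

text \<open>The extra factor \<open>x\<close> makes the lowest exponent 1 and moves the bound by
  one.\<close>

lemma set_integrable_gen_hermite_odd:
  assumes "\<mu> > -1/2" "Re s > - \<mu> - 1"
  shows "set_integrable lborel {0<..} (mellin_integrand \<mu> (gen_hermite \<mu> (2 * m + 1)) s)"
proof -
  have "gen_hermite \<mu> (2 * m + 1) = (\<lambda>x. \<Sum>k\<le>m. (-1) ^ m * 2 ^ (2 * m + 1) * fact m *
      ((-1) ^ k * ((real m + (\<mu> + 1/2)) gchoose (m - k)) / fact k) * x ^ (2 * k + 1))"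
    using assms(1) unfolding gen_hermite_odd
    by (simp add: fun_eq_iff laguerre_eq_sum sum_distrib_left mult_ac flip: power_mult)
  then show ?thesis
    using assms(2) by (simp only:) (rule set_integrable_mellin_sum, auto)
qed

section \<open>Recursions of the Mellin transforms\<close>

text \<open>Both recursions are instances: the factor \<open>x\<close> raises \<open>s\<close> to
  \<open>s + 1\<close>, and the two integrability assumptions justify linearity of the
  integral.\<close>

lemma hermite_mellin_rec:
  assumes rec: "\<And>x. gen_hermite \<mu> l x = a * x * gen_hermite \<mu> m x - b * gen_hermite \<mu> n x"
    and int_m: "set_integrable lborel {0<..} (mellin_integrand \<mu> (gen_hermite \<mu> m) (s + 1))"
    and int_n: "set_integrable lborel {0<..} (mellin_integrand \<mu> (gen_hermite \<mu> n) s)"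
  shows "hermite_mellin \<mu> l s
    = of_real a * hermite_mellin \<mu> m (s + 1) - of_real b * hermite_mellin \<mu> n s"
proof -
  have "mellin_integrand \<mu> (gen_hermite \<mu> l) s x
      = of_real a * mellin_integrand \<mu> (gen_hermite \<mu> m) (s + 1) x
        - of_real b * mellin_integrand \<mu> (gen_hermite \<mu> n) s x" if "x \<in> {0<..}" for x
  proof -
    have "complex_of_real x powr (s + 1 - 1) = complex_of_real x powr (s - 1) * complex_of_real x"
      using powr_add[of "complex_of_real x" "s - 1" 1] that by simp
    then show ?thesis
      by (simp add: rec algebra_simps)
  qed
  then have "hermite_mellin \<mu> l s
      = (LINT x:{0<..}|lborel. of_real a * mellin_integrand \<mu> (gen_hermite \<mu> m) (s + 1) x
        - of_real b * mellin_integrand \<mu> (gen_hermite \<mu> n) s x)"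
    unfolding hermite_mellin_def by (intro set_lebesgue_integral_cong) auto
  also have "\<dots> = of_real a * hermite_mellin \<mu> m (s + 1) - of_real b * hermite_mellin \<mu> n s"
    unfolding hermite_mellin_def
    by (simp only: set_integral_diff set_integrable_mult_right int_m int_n set_integral_mult_right)
  finally show ?thesis .
qed

text \<open>Even indices require \<open>Re s > - \<mu>\<close> for convergence. The first recursion
  has an even index at \<open>s + 1\<close>, where this follows from the assumptions; the second has
  even indices at \<open>s\<close> itself, hence its guard.\<close>

theorem proposition2:
  fixes \<mu> :: real and m :: nat and s :: complex
  assumes "\<mu> > -1/2" and "Re s > 0"
  shows "hermite_mellin \<mu> (2 * m + 1) s =
           2 * hermite_mellin \<mu> (2 * m) (s + 1)
           - (if m = 0 then 0 else 4 * of_nat m * hermite_mellin \<mu> (2 * m - 1) s)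
       \<and> (Re s > - \<mu> \<longrightarrow>
           hermite_mellin \<mu> (2 * m + 2) s =
             2 * hermite_mellin \<mu> (2 * m + 1) (s + 1)
             - 2 * complex_of_real (2 * real m + 2 * \<mu> + 1) * hermite_mellin \<mu> (2 * m) s)"
proof (intro conjI impI)
  have even: "set_integrable lborel {0<..} (mellin_integrand \<mu> (gen_hermite \<mu> (2 * m)) (s + 1))"
    using assms by (intro set_integrable_gen_hermite_even) auto
  show "hermite_mellin \<mu> (2 * m + 1) s = 2 * hermite_mellin \<mu> (2 * m) (s + 1)
      - (if m = 0 then 0 else 4 * of_nat m * hermite_mellin \<mu> (2 * m - 1) s)"
  proof (cases m)
    case 0
    \<comment> \<open>For \<open>m = 0\<close> the index \<open>2 * m - 1\<close> truncates to \<open>0\<close>, and \<open>gen_hermite \<mu> 0\<close> need not be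
      integrable at \<open>s\<close>; index \<open>1\<close> with coefficient \<open>0\<close> serves instead.\<close>
    have "set_integrable lborel {0<..} (mellin_integrand \<mu> (gen_hermite \<mu> (2 * 0 + 1)) s)"
      using assms by (intro set_integrable_gen_hermite_odd) auto
    then show ?thesis
      using hermite_mellin_rec[of \<mu> "2 * m + 1" 2 "2 * m" 0 1 s] even
        gen_hermite_odd_rec[OF assms(1), of 0] 0 by simp
  next
    case (Suc n)
    have "set_integrable lborel {0<..} (mellin_integrand \<mu> (gen_hermite \<mu> (2 * n + 1)) s)"
      using assms by (intro set_integrable_gen_hermite_odd) auto
    moreover have "2 * m - 1 = 2 * n + 1" using Suc by simp
    ultimately show ?thesis
      using hermite_mellin_rec[OF gen_hermite_odd_rec[OF assms(1)] even] Suc by simp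
  qed
next
  assume "Re s > - \<mu>"
  then have "set_integrable lborel {0<..} (mellin_integrand \<mu> (gen_hermite \<mu> (2 * m)) s)"
    using assms by (intro set_integrable_gen_hermite_even)
  moreover have "set_integrable lborel {0<..}
      (mellin_integrand \<mu> (gen_hermite \<mu> (2 * m + 1)) (s + 1))"
    using assms by (intro set_integrable_gen_hermite_odd) auto
  ultimately show "hermite_mellin \<mu> (2 * m + 2) s = 2 * hermite_mellin \<mu> (2 * m + 1) (s + 1)
      - 2 * complex_of_real (2 * real m + 2 * \<mu> + 1) * hermite_mellin \<mu> (2 * m) s"
    using hermite_mellin_rec[OF gen_hermite_even_rec[OF assms(1), of m]] by simp
qed

end
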